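(* Let $\mathcal{Z}\subset\mathbb{R}^d$ be nonempty, closed and convex, and let $F:\mathcal{Z}\to\mathbb{R}^d$ be a monotone operator that is locally Lipschitz continuous on $\mathcal{Z}$. Assume the variational inequality $\langle F(z_* ),z-z_*\rangle\ge 0$ for all $z\in\mathcal{Z}$ has a solution $z_*\in\mathcal{Z}$. Let $z_0\in\mathcal{Z}$, $\eta_0>0$, $\theta\in(0,1)$, $\rho\in(0,1)$, and let $(\lambda_t)_{t\ge0}$ satisfy $\lambda_t\ge1$ for all $t$ and $\lim_{t\to\infty}\lambda_t=1$. Suppose the PF-NE-EG algorithm with non-monotone backtracking line search described in the context, run with these inputs, never stops, so that it produces infinite sequences $(z_t)$, $(w_t)$, $(\eta_t)$. Then the extragradient residual satisfies $$\|F(z_T)+\xi_T\|_2=o(1/\sqrt{T})\quad\text{as }T\to\infty .$$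
   Context: $F$ is monotone if $\langle F(z)-F(w),z-w\rangle\ge0$ for all $z,w\in\mathcal{Z}$. $F$ is locally Lipschitz on $\mathcal{Z}$ if for every $z\in\mathcal{Z}$ there are $L(z)>0$ and a (relative) neighborhood $N(z)\subset\mathcal{Z}$ of $z$ with $\|F(z')-F(z'')\|_2\le L(z)\|z'-z''\|_2$ for all $z',z''\in N(z)$. $\mathrm{Proj}_{\mathcal{Z}}$ is the Euclidean projection onto $\mathcal{Z}$. Extragradient update with stepsize $\eta_t>0$: $w_t=\mathrm{Proj}_{\mathcal{Z}}(z_t-\eta_tF(z_t))$, $z_{t+1}=\mathrm{Proj}_{\mathcal{Z}}(z_t-\eta_tF(w_t))$. Local Lipschitz estimates: $L_t=\|F(w_t)-F(z_t)\|_2/\|w_t-z_t\|_2$ (defined when $w_t\ne z_t$); $\hat L_t=\|F(w_t)-F(z_{t+1})\|_2/\|w_t-z_{t+1}\|_2$ if $w_t\ne z_{t+1}$, and $\hat L_t=0$ if $w_t=z_{t+1}$. PF-NE-EG algorithm with non-monotone backtracking line search: compute $w_0,z_1$ by the extragradient update from $z_0$ with stepsize $\eta_0$ (stop and return $z_0$ if $w_0=z_0$). For $t=1,2,\dots$: (1) Set $\bar\eta_t=\min\{\lambda_{t-1}\eta_{t-1},\ \theta/L_{t-1},\ \theta/\hat L_{t-1}\}$, where $\theta/0$ is read as $+\infty$. (2) For $\eta>0$ let $w_t(\eta)=\mathrm{Proj}_{\mathcal{Z}}(z_t-\eta F(z_t))$ and $z_{t+1}(\eta)=\mathrm{Proj}_{\mathcal{Z}}(z_t-\eta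 F(w_t(\eta)))$. Starting with $\eta=\bar\eta_t$, repeatedly replace $\eta$ by $\rho\eta$ until both $\eta\,\|F(w_t(\eta))-F(z_t)\|_2/\|w_t(\eta)-z_t\|_2\le\frac{\theta+1}{2}$ and, if $w_t(\eta)\ne z_{t+1}(\eta)$, $\eta\,\|F(w_t(\eta))-F(z_{t+1}(\eta))\|_2/\|w_t(\eta)-z_{t+1}(\eta)\|_2\le1$ hold; if $w_t(\eta)=z_t$ is encountered, stop and return $z_t$ (which is then a solution). Set $\eta_t=\eta$. (3) Compute $w_t,z_{t+1}$ by the extragradient update with stepsize $\eta_t$. For $t\ge0$, $\xi_{t+1}=-\frac1{\eta_t}\left[z_{t+1}-(z_t-\eta_tF(w_t))\right]$; the extragradient residual at $z_{t+1}$ is $\|F(z_{t+1})+\xi_{t+1}\|_2$. *)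

theory Defs
  imports "HOL-Analysis.Analysis" "HOL-Library.Landau_Symbols"
begin

text \<open>
  An operator on a set \<open>Z\<close> is a total function whose values outside \<open>Z\<close> are irrelevant.
  The Euclidean projection onto a nonempty closed convex set is \<^const>\<open>closest_point\<close>.
\<close>

definition monotone_operator_on :: "'a::real_inner set \<Rightarrow> ('a \<Rightarrow> 'a) \<Rightarrow> bool" where
  "monotone_operator_on Z F \<longleftrightarrow> (\<forall>z\<in>Z. \<forall>w\<in>Z. (F z - F w) \<bullet> (z - w) \<ge> 0)"

definition locally_lipschitz_on :: "'a::real_normed_vector set \<Rightarrow> ('a \<Rightarrow> 'a) \<Rightarrow> bool" where
  "locally_lipschitz_on Z F \<longleftrightarrow>
     (\<forall>z\<in>Z. \<exists>L>0. \<exists>N. openin (top_of_set Z) N \<and> z \<in> N \<and>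
        (\<forall>z'\<in>N. \<forall>z''\<in>N. norm (F z' - F z'') \<le> L * norm (z' - z'')))"

definition vi_solution :: "'a::real_inner set \<Rightarrow> ('a \<Rightarrow> 'a) \<Rightarrow> 'a \<Rightarrow> bool" where
  "vi_solution Z F zs \<longleftrightarrow> zs \<in> Z \<and> (\<forall>z\<in>Z. F zs \<bullet> (z - zs) \<ge> 0)"

definition eg_w :: "'a::euclidean_space set \<Rightarrow> ('a \<Rightarrow> 'a) \<Rightarrow> 'a \<Rightarrow> real \<Rightarrow> 'a" where
  "eg_w Z F z \<eta> = closest_point Z (z - \<eta> *\<^sub>R F z)"

definition eg_z :: "'a::euclidean_space set \<Rightarrow> ('a \<Rightarrow> 'a) \<Rightarrow> 'a \<Rightarrow> real \<Rightarrow> 'a" where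
  "eg_z Z F z \<eta> = closest_point Z (z - \<eta> *\<^sub>R F (eg_w Z F z \<eta>))"

text \<open>
  With \<open>w = w\<^sub>t\<close>, the first estimate \<open>L\<^sub>t\<close> is obtained for \<open>y = z\<^sub>t\<close>
  and the second one for \<open>y = z\<^sub>t\<^sub>+\<^sub>1\<close>. The value \<open>0\<close> at \<open>w = y\<close> is
  the convention for the second estimate; the first one is never used in that case.
\<close>

definition lip_est :: "('a::real_normed_vector \<Rightarrow> 'a) \<Rightarrow> 'a \<Rightarrow> 'a \<Rightarrow> real" where
  "lip_est F w y = (if w = y then 0 else norm (F w - F y) / norm (w - y))"

text \<open>
  Initial trial stepsize. The quotients are taken in \<^typ>\<open>ereal\<close>, where \<open>\<theta> / 0 = \<infinity>\<close>
  for \<open>\<theta> > 0\<close>; the minimum is finite because of its first argument.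
\<close>

definition trial_step :: "real \<Rightarrow> real \<Rightarrow> real \<Rightarrow> real \<Rightarrow> real \<Rightarrow> real" where
  "trial_step \<theta> l \<eta> L Lhat =
     real_of_ereal (min (ereal (l * \<eta>)) (min (ereal \<theta> / ereal L) (ereal \<theta> / ereal Lhat)))"

definition step_accepted ::
  "'a::euclidean_space set \<Rightarrow> ('a \<Rightarrow> 'a) \<Rightarrow> real \<Rightarrow> 'a \<Rightarrow> real \<Rightarrow> bool" where
  "step_accepted Z F \<theta> z \<eta> \<longleftrightarrow>
     (let w = eg_w Z F z \<eta>; z' = eg_z Z F z \<eta> in
        \<eta> * (norm (F w - F z) / norm (w - z)) \<le> (\<theta> + 1) / 2 \<and>
        (w \<noteq> z' \<longrightarrow> \<eta> * (norm (F w - F z') / norm (w - z')) \<le> 1))"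

text \<open>
  \<open>backtracks_to Z F \<theta> \<rho> z \<eta>0 \<eta>\<close>: the line search at \<open>z\<close> started with \<open>\<eta>0\<close> ends with
  the stepsize \<open>\<eta>\<close>, that is, \<open>\<eta>\<close> is the first accepted one among \<open>\<eta>0, \<rho> \<eta>0, \<rho>\<^sup>2 \<eta>0, \<dots>\<close>, and
  no stepsize tried meets the stopping criterion \<open>w = z\<close>.
\<close>

definition backtracks_to ::
  "'a::euclidean_space set \<Rightarrow> ('a \<Rightarrow> 'a) \<Rightarrow> real \<Rightarrow> real \<Rightarrow> 'a \<Rightarrow> real \<Rightarrow> real \<Rightarrow> bool" where
  "backtracks_to Z F \<theta> \<rho> z \<eta>0 \<eta> \<longleftrightarrow>
     (\<exists>k. \<eta> = \<rho> ^ k * \<eta>0 \<and>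
          step_accepted Z F \<theta> z \<eta> \<and>
          (\<forall>j<k. \<not> step_accepted Z F \<theta> z (\<rho> ^ j * \<eta>0)) \<and>
          (\<forall>j\<le>k. eg_w Z F z (\<rho> ^ j * \<eta>0) \<noteq> z))"

text \<open>
  \<open>z\<close>, \<open>w\<close>, \<open>\<eta>\<close> are the sequences of a run that never stops, with inputs \<open>z0\<close>, \<open>\<eta>0\<close>,
  \<open>\<theta>\<close>, \<open>\<rho>\<close> and \<open>l\<close> (the sequence \<open>\<lambda>\<^sub>t\<close>).
\<close>

definition pf_ne_eg_infinite_run ::
  "'a::euclidean_space set \<Rightarrow> ('a \<Rightarrow> 'a) \<Rightarrow> 'a \<Rightarrow> real \<Rightarrow> real \<Rightarrow> real \<Rightarrow> (nat \<Rightarrow> real) \<Rightarrow>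
   (nat \<Rightarrow> 'a) \<Rightarrow> (nat \<Rightarrow> 'a) \<Rightarrow> (nat \<Rightarrow> real) \<Rightarrow> bool" where
  "pf_ne_eg_infinite_run Z F z0 \<eta>0 \<theta> \<rho> l z w \<eta> \<longleftrightarrow>
     z 0 = z0 \<and> \<eta> 0 = \<eta>0 \<and> w 0 \<noteq> z 0 \<and>
     (\<forall>t. w t = eg_w Z F (z t) (\<eta> t) \<and> z (Suc t) = eg_z Z F (z t) (\<eta> t)) \<and>
     (\<forall>t. backtracks_to Z F \<theta> \<rho> (z (Suc t))
            (trial_step \<theta> (l t) (\<eta> t) (lip_est F (w t) (z t)) (lip_est F (w t) (z (Suc t))))
            (\<eta> (Suc t)))"

end

theory Submission
  imports Defs
begin

text \<open>
  The residual is nonincreasing from one step to the next, whatever the two stepsizes are: this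
  needs only the second acceptance test, which bounds the Lipschitz estimate between
  \<open>w\<^sub>t\<close> and \<open>z\<^sub>t\<^sub>+\<^sub>1\<close> by \<open>1 / \<eta>\<^sub>t\<close>. The first test gives Fejer monotonicity towards a solution and
  \<open>\<Sum> \<parallel>w\<^sub>t - z\<^sub>t\<parallel>\<^sup>2 + \<parallel>w\<^sub>t - z\<^sub>t\<^sub>+\<^sub>1\<parallel>\<^sup>2 < \<infinity>\<close>. Hence the iterates stay in a compact set, where
  \<open>F\<close> is Lipschitz, so the stepsizes are bounded away from \<open>0\<close> and the squared residuals are
  summable as well. A nonincreasing summable sequence is \<open>o(1/T)\<close>.
\<close>

section \<open>Lipschitz constants on compact sets; nonnegative series\<close>

lemma locally_lipschitz_on_compact:
  assumes lip: "locally_lipschitz_on Z F" and K: "compact K" "K \<subseteq> Z"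
  obtains L where "L > 0" "\<And>x y. x \<in> K \<Longrightarrow> y \<in> K \<Longrightarrow> norm (F x - F y) \<le> L * norm (x - y)"
proof -
  \<comment> \<open>\<open>F\<close> is read as a time-independent field over the dummy time set
    \<open>{0}\<close>, so that the compactness theorem for \<open>local_lipschitz\<close> merges
    the local constants into one.\<close>
  have "local_lipschitz {0::real} K (\<lambda>_. F)"
  proof (rule local_lipschitzI)
    fix t :: real and x assume "x \<in> K"
    then obtain L N where L: "L > 0" "openin (top_of_set Z) N" "x \<in> N"
      and N: "\<And>z' z''. z' \<in> N \<Longrightarrow> z'' \<in> N \<Longrightarrow> norm (F z' - F z'') \<le> L * norm (z' - z'')"
      using lip K(2) unfolding locally_lipschitz_on_def by (meson subsetD)
    obtain u where u: "u > 0" "cball x u \<inter> Z \<subseteq> N"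
      using L(2,3) unfolding openin_contains_cball by blast
    have "L-lipschitz_on (cball x u \<inter> K) F"
      using L(1) N u(2) K(2) by (intro lipschitz_onI) (auto simp: dist_norm subset_iff)
    then show "\<exists>u>0. \<exists>L. \<forall>t\<in>cball t u \<inter> {0}. L-lipschitz_on (cball x u \<inter> K) F"
      using u(1) by blast
  qed
  then obtain L where L: "L-lipschitz_on K F"
    using local_lipschitz_compact_implies_lipschitz[OF _ K(1), of "{0::real}" "\<lambda>_. F"] by auto
  \<comment> \<open>The constant obtained is only nonnegative; adding 1 makes it positive.\<close>
  then have "norm (F x - F y) \<le> (L + 1) * norm (x - y)" if "x \<in> K" "y \<in> K" for x y
    using lipschitz_onD[OF L that] norm_ge_zero[of "x - y"] unfolding dist_norm distrib_right
    by linarith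
  moreover have "L + 1 > 0"
    using lipschitz_on_nonneg[OF L] by simp
  ultimately show thesis
    using that by blast
qed

lemma lipschitz_on_bounded_set_norm_le:
  fixes F :: "'a::real_normed_vector \<Rightarrow> 'b::real_normed_vector"
  assumes L: "\<And>x y. x \<in> K \<Longrightarrow> y \<in> K \<Longrightarrow> norm (F x - F y) \<le> L * norm (x - y)"
    and "0 < L" "c \<in> K" "x \<in> K" "norm (x - c) \<le> R"
  shows "norm (F x) \<le> norm (F c) + L * R"
proof -
  have "norm (F x) \<le> norm (F c) + norm (F x - F c)"
    using norm_triangle_ineq[of "F c" "F x - F c"] by simp
  also have "norm (F x - F c) \<le> L * norm (x - c)"
    using L assms by blast
  also have "\<dots> \<le> L * R"
    using assms by (intro mult_left_mono) auto
  finally show ?thesis by simp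
qed

lemma antimono_summable_times_index_tendsto_0:
  fixes f :: "nat \<Rightarrow> real"
  assumes nonneg: "\<And>n. 0 \<le> f n" and anti: "antimono f" and summ: "summable f"
  shows "(\<lambda>n. real n * f n) \<longlonglongrightarrow> 0"
proof (rule LIMSEQ_I)
  fix e :: real assume "e > 0"
  then obtain N where N: "\<And>m n. m \<ge> N \<Longrightarrow> norm (sum f {m..<n}) < e / 2"
    using summ unfolding summable_Cauchy by (metis half_gt_zero)
  have "norm (real n * f n - 0) < e" if "n \<ge> 2 * N" for n
  proof -
    \<comment> \<open>The upper half of \<open>{..<n}\<close> has at least \<open>n / 2\<close>
      indices, and \<open>f\<close> is at least \<open>f n\<close> on each of them; the sum over
      this half is a Cauchy block.\<close>
    have "real n * f n \<le> 2 * (real (n - n div 2) * f n)"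
      using nonneg[of n] by (simp flip: mult.assoc add: mult_right_mono)
    also have "real (n - n div 2) * f n = (\<Sum>k\<in>{n div 2..<n}. f n)"
      by simp
    also have "\<dots> \<le> sum f {n div 2..<n}"
      by (intro sum_mono antimonoD[OF anti]) auto
    also have "\<dots> < e / 2"
      using N[of "n div 2" n] that by force
    finally show ?thesis
      using nonneg[of n] by simp
  qed
  then show "\<exists>no. \<forall>n\<ge>no. norm (real n * f n - 0) < e"
    by blast
qed

lemma summable_telescoping_bound:
  fixes f g :: "nat \<Rightarrow> real"
  assumes "\<And>n. 0 \<le> f n" "\<And>n. 0 \<le> g n" "\<And>n. f (Suc n) \<le> f n - g n"
  shows "summable g"
proof (rule summableI_nonneg_bounded)
  fix n
  have "(\<Sum>i<n. g i) \<le> (\<Sum>i<n. f i - f (Suc i))"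
    using assms(3) by (intro sum_mono) (simp add: le_diff_eq add.commute)
  also have "\<dots> = f 0 - f n"
    by (rule sum_lessThan_telescope')
  finally show "(\<Sum>i<n. g i) \<le> f 0"
    using assms(1)[of n] by linarith
qed (rule assms(2))

section \<open>Inequalities for a single extragradient step\<close>

text \<open>
  The difference of the two sides is a sum of nonnegative terms: the premises enter with
  weight \<open>2\<close> (monotonicity and the three normal cone inequalities) and weight \<open>1\<close> (the Lipschitz
  estimate), and the square \<open>\<parallel>a + c - (z - w)\<parallel>\<^sup>2\<close> remains.
\<close>

lemma extragradient_residual_inequality:
  fixes z w z' a b d c :: "'a::real_inner"
  assumes "0 \<le> (a - d) \<bullet> (z - z')"
    and "norm (b - d) \<le> norm (w - z')"
    and "0 \<le> c \<bullet> (z - w)"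
    and "0 \<le> (z - a - w) \<bullet> (w - z')"
    and "0 \<le> (z - b - z') \<bullet> (z' - z)"
  shows "norm (d + (z - b - z')) \<le> norm (a + c)"
proof -
  have "(norm (b - d))\<^sup>2 \<le> (norm (w - z'))\<^sup>2"
    using assms(2) by (simp add: power_mono)
  moreover have "0 \<le> (norm (a + c - (z - w)))\<^sup>2"
    by simp
  moreover have "(norm (a + c))\<^sup>2 - (norm (d + (z - b - z')))\<^sup>2 =
     2 * ((a - d) \<bullet> (z - z')) + ((norm (w - z'))\<^sup>2 - (norm (b - d))\<^sup>2)
     + 2 * (c \<bullet> (z - w)) + 2 * ((z - a - w) \<bullet> (w - z')) + 2 * ((z - b - z') \<bullet> (z' - z))
     + (norm (a + c - (z - w)))\<^sup>2"
    unfolding power2_norm_eq_inner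
    by (simp only: inner_diff_left inner_diff_right inner_add_left inner_add_right inner_commute) argo
  ultimately have "(norm (d + (z - b - z')))\<^sup>2 \<le> (norm (a + c))\<^sup>2"
    using assms by linarith
  then show ?thesis
    by (simp add: abs_le_square_iff[symmetric])
qed

text \<open>Here \<open>a\<close> and \<open>b\<close> stand for \<open>F z\<close> and
  \<open>F w\<close> times the stepsize, and \<open>s\<close> for a solution. Expanding the squares
  leaves three nonnegative terms and one cross term, which Cauchy-Schwarz and
  \<open>2xy \<le> x^2 + y^2\<close> bound by the fraction \<open>\<kappa>\<close> of the two
  squared distances.\<close>

lemma extragradient_fejer_inequality:
  fixes z w z' a b s :: "'a::real_inner"
  assumes "norm (b - a) \<le> \<kappa> * norm (w - z)" "0 \<le> \<kappa>"
    and "0 \<le> b \<bullet> (w - s)"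
    and "0 \<le> (z - a - w) \<bullet> (w - z')"
    and "0 \<le> (z - b - z') \<bullet> (z' - s)"
  shows "(norm (z' - s))\<^sup>2 \<le> (norm (z - s))\<^sup>2 - (1 - \<kappa>) * ((norm (w - z))\<^sup>2 + (norm (w - z'))\<^sup>2)"
proof -
  have "2 * ((b - a) \<bullet> (w - z')) \<le> 2 * (norm (b - a) * norm (w - z'))"
    using norm_cauchy_schwarz[of "b - a" "w - z'"] by simp
  also have "\<dots> \<le> \<kappa> * (2 * norm (w - z) * norm (w - z'))"
    using mult_right_mono[OF assms(1), of "norm (w - z')"] by simp
  also have "\<dots> \<le> \<kappa> * ((norm (w - z))\<^sup>2 + (norm (w - z'))\<^sup>2)"
    using assms(2) by (intro mult_left_mono sum_squares_bound)
  finally have "2 * ((b - a) \<bullet> (w - z')) \<le> \<kappa> * ((norm (w - z))\<^sup>2 + (norm (w - z'))\<^sup>2)" .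
  moreover have "(norm (z - s))\<^sup>2 - (norm (z' - s))\<^sup>2 - ((norm (w - z))\<^sup>2 + (norm (w - z'))\<^sup>2)
      + 2 * ((b - a) \<bullet> (w - z')) =
     2 * (b \<bullet> (w - s)) + 2 * ((z - a - w) \<bullet> (w - z')) + 2 * ((z - b - z') \<bullet> (z' - s))"
    unfolding power2_norm_eq_inner
    by (simp only: inner_diff_left inner_diff_right inner_add_left inner_add_right inner_commute) argo
  ultimately show ?thesis
    using assms by (simp add: left_diff_distrib)
qed

section \<open>Trial stepsize and acceptance tests\<close>

lemma trial_step_ge:
  assumes "0 < m" "0 < \<theta>" "0 \<le> L" "0 \<le> Lhat"
    and "m \<le> l * \<eta>" "m * L \<le> \<theta>" "m * Lhat \<le> \<theta>"
  shows "m \<le> trial_step \<theta> l \<eta> L Lhat"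
proof -
  \<comment> \<open>Premises in product form also cover \<open>K = 0\<close>, where the quotient is
    infinite.\<close>
  have quot: "ereal m \<le> ereal \<theta> / ereal K" if "0 \<le> K" "m * K \<le> \<theta>" for K
    using that assms(2) by (cases "K = 0") (auto simp: field_simps)
  define M where "M = min (ereal (l * \<eta>)) (min (ereal \<theta> / ereal L) (ereal \<theta> / ereal Lhat))"
  have "ereal m \<le> M"
    unfolding M_def using quot assms by simp
  \<comment> \<open>Finiteness matters: \<open>real_of_ereal\<close> sends both infinities to
    0.\<close>
  moreover have "M \<le> ereal (l * \<eta>)"
    unfolding M_def by simp
  ultimately have "m \<le> real_of_ereal M"
    by (cases M) auto
  then show ?thesis
    by (simp add: trial_step_def M_def)
qed

lemma trial_step_pos:
  assumes "0 < \<theta>" "0 \<le> L" "0 \<le> Lhat" "0 < l * \<eta>"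
  shows "0 < trial_step \<theta> l \<eta> L Lhat"
proof -
  \<comment> \<open>The denominators are raised by 1 so that a vanishing estimate causes no division
    by zero.\<close>
  define m where "m = min (l * \<eta>) (min (\<theta> / (L + 1)) (\<theta> / (Lhat + 1)))"
  have m: "0 < m"
    using assms by (simp add: m_def)
  have "m * K \<le> \<theta>" if "0 \<le> K" "m \<le> \<theta> / (K + 1)" for K
  proof -
    have "m * K \<le> m * (K + 1)"
      using m by simp
    also have "\<dots> \<le> \<theta>"
      using that by (simp add: field_simps)
    finally show ?thesis .
  qed
  moreover have "m \<le> l * \<eta>" "m \<le> \<theta> / (L + 1)" "m \<le> \<theta> / (Lhat + 1)"
    by (simp_all add: m_def)
  ultimately have "m \<le> trial_step \<theta> l \<eta> L Lhat"
    using assms by (intro trial_step_ge m) auto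
  then show ?thesis
    using m by linarith
qed

lemma lip_est_nonneg: "0 \<le> lip_est F w y"
  by (simp add: lip_est_def)

lemma lip_est_le:
  assumes "norm (F w - F y) \<le> L * norm (w - y)" "0 \<le> L"
  shows "lip_est F w y \<le> L"
  using assms by (simp add: lip_est_def pos_divide_le_eq)

text \<open>Division by zero yields 0 in HOL, which agrees with the convention at
  \<open>w = y\<close>.\<close>

lemma lip_est_eq: "lip_est F w y = norm (F w - F y) / norm (w - y)"
  by (simp add: lip_est_def)

text \<open>After the denominators are cleared, both sides vanish at coinciding points, so the side
  condition of the second test disappears.\<close>

lemma step_acceptedD:
  assumes "step_accepted Z F \<theta> z \<eta>" "0 \<le> \<eta>"
  defines "w \<equiv> eg_w Z F z \<eta>" and "z' \<equiv> eg_z Z F z \<eta>"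
  shows "norm (\<eta> *\<^sub>R F w - \<eta> *\<^sub>R F z) \<le> (\<theta> + 1) / 2 * norm (w - z)"
    and "norm (\<eta> *\<^sub>R F w - \<eta> *\<^sub>R F z') \<le> norm (w - z')"
proof -
  have scaled: "norm (\<eta> *\<^sub>R F w - \<eta> *\<^sub>R F y) \<le> C * norm (w - y)"
    if "w \<noteq> y \<Longrightarrow> \<eta> * (norm (F w - F y) / norm (w - y)) \<le> C" for y C
    using that assms(2) by (cases "w = y") (simp_all add: pos_divide_le_eq flip: scaleR_diff_right)
  have acc: "\<eta> * (norm (F w - F z) / norm (w - z)) \<le> (\<theta> + 1) / 2"
    "w \<noteq> z' \<Longrightarrow> \<eta> * (norm (F w - F z') / norm (w - z')) \<le> 1"
    using assms(1) by (simp_all add: step_accepted_def Let_def w_def z'_def)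
  show "norm (\<eta> *\<^sub>R F w - \<eta> *\<^sub>R F z) \<le> (\<theta> + 1) / 2 * norm (w - z)"
    by (rule scaled) (rule acc)
  show "norm (\<eta> *\<^sub>R F w - \<eta> *\<^sub>R F z') \<le> norm (w - z')"
    using scaled[OF acc(2)] by simp
qed

text \<open>Failure of the first test gives the bound at once; failure of the second gives
  \<open>1 < \<eta> * L\<close>, which is stronger because \<theta> < 1.\<close>

lemma step_rejected_lower_bound:
  assumes "\<not> step_accepted Z F \<theta> z \<eta>" "0 \<le> \<eta>" "\<theta> < 1" "0 \<le> L"
    and "norm (F (eg_w Z F z \<eta>) - F z) \<le> L * norm (eg_w Z F z \<eta> - z)"
    and "norm (F (eg_w Z F z \<eta>) - F (eg_z Z F z \<eta>)) \<le> L * norm (eg_w Z F z \<eta> - eg_z Z F z \<eta>)"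
  shows "(\<theta> + 1) / 2 < \<eta> * L"
proof -
  have "(\<theta> + 1) / 2 < \<eta> * lip_est F (eg_w Z F z \<eta>) z \<or>
      1 < \<eta> * lip_est F (eg_w Z F z \<eta>) (eg_z Z F z \<eta>)"
    using assms(1) by (auto simp: step_accepted_def Let_def lip_est_eq)
  then show ?thesis
    using mult_left_mono[OF lip_est_le[OF assms(5,4)] assms(2)]
      mult_left_mono[OF lip_est_le[OF assms(6,4)] assms(2)] assms(3) by argo
qed

section \<open>Basic properties of a run\<close>

locale pf_ne_eg =
  fixes Z :: "'a::euclidean_space set" and F :: "'a \<Rightarrow> 'a" and zs :: 'a
    and \<theta> \<rho> :: real and l :: "nat \<Rightarrow> real"
    and z w :: "nat \<Rightarrow> 'a" and \<eta> :: "nat \<Rightarrow> real"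
  assumes closed: "closed Z" and convex: "convex Z"
    and mono: "monotone_operator_on Z F"
    and loc_lip: "locally_lipschitz_on Z F"
    and sol: "vi_solution Z F zs"
    and z0: "z 0 \<in> Z" and \<eta>0: "\<eta> 0 > 0"
    and \<theta>: "0 < \<theta>" "\<theta> < 1" and \<rho>: "0 < \<rho>" "\<rho> < 1"
    and l: "\<And>t. l t \<ge> 1"
    and w_eq: "\<And>t. w t = eg_w Z F (z t) (\<eta> t)"
    and z_eq: "\<And>t. z (Suc t) = eg_z Z F (z t) (\<eta> t)"
    and line_search: "\<And>t. backtracks_to Z F \<theta> \<rho> (z (Suc t))
            (trial_step \<theta> (l t) (\<eta> t) (lip_est F (w t) (z t)) (lip_est F (w t) (z (Suc t))))
            (\<eta> (Suc t))"
begin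

definition \<kappa> :: real where "\<kappa> = (\<theta> + 1) / 2"

lemma \<kappa>: "0 < \<kappa>" "\<kappa> < 1"
  using \<theta> by (auto simp: \<kappa>_def)

lemma zs_in: "zs \<in> Z"
  using sol by (simp add: vi_solution_def)

lemma closest_point_in: "closest_point Z x \<in> Z"
  using closest_point_in_set[OF closed] zs_in by blast

lemma projection_normal: "y \<in> Z \<Longrightarrow> 0 \<le> (x - closest_point Z x) \<bullet> (closest_point Z x - y)"
  using closest_point_dot[OF convex closed, of y x] by (simp add: inner_diff_right)

lemma eg_in: "eg_w Z F x h \<in> Z" "eg_z Z F x h \<in> Z"
  by (simp_all add: eg_w_def eg_z_def closest_point_in)

lemma iterates_in: "z t \<in> Z" "w t \<in> Z"
  using z0 by (cases t; simp add: z_eq w_eq eg_in)+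

text \<open>The projection is nonexpansive and fixes \<open>x\<close>.\<close>

lemma eg_w_displacement:
  assumes "x \<in> Z" "0 \<le> h"
  shows "norm (eg_w Z F x h - x) \<le> h * norm (F x)"
    and "norm (eg_z Z F x h - x) \<le> h * norm (F (eg_w Z F x h))"
  using closest_point_lipschitz[OF convex closed, of "x - h *\<^sub>R F x" x]
    closest_point_lipschitz[OF convex closed, of "x - h *\<^sub>R F (eg_w Z F x h)" x] zs_in assms
  by (auto simp: eg_w_def eg_z_def closest_point_self dist_norm)

lemma \<eta>_pos: "0 < \<eta> t"
proof (induction t)
  case (Suc t)
  have "0 < l t * \<eta> t"
    using Suc l[of t] by simp
  then have "0 < trial_step \<theta> (l t) (\<eta> t) (lip_est F (w t) (z t)) (lip_est F (w t) (z (Suc t)))"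
    by (intro trial_step_pos \<theta> lip_est_nonneg)
  then show ?case
    using line_search[of t] \<rho> by (auto simp: backtracks_to_def)
qed (rule \<eta>0)

lemma normal_w: "y \<in> Z \<Longrightarrow> 0 \<le> (z t - \<eta> t *\<^sub>R F (z t) - w t) \<bullet> (w t - y)"
  unfolding w_eq eg_w_def by (rule projection_normal)

lemma normal_z: "y \<in> Z \<Longrightarrow> 0 \<le> (z t - \<eta> t *\<^sub>R F (w t) - z (Suc t)) \<bullet> (z (Suc t) - y)"
  unfolding z_eq eg_z_def w_eq[symmetric] by (rule projection_normal)

text \<open>The stepsize \<open>\<eta> 0\<close> is an input and undergoes no line search, so these
  estimates, and all that rests on them, start at index 1.\<close>

lemma accepted:
  "norm (\<eta> (Suc t) *\<^sub>R F (w (Suc t)) - \<eta> (Suc t) *\<^sub>R F (z (Suc t))) \<le> \<kappa> * norm (w (Suc t) - z (Suc t))"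
  "norm (\<eta> (Suc t) *\<^sub>R F (w (Suc t)) - \<eta> (Suc t) *\<^sub>R F (z (Suc (Suc t)))) \<le> norm (w (Suc t) - z (Suc (Suc t)))"
proof -
  have "step_accepted Z F \<theta> (z (Suc t)) (\<eta> (Suc t))"
    using line_search[of t] by (auto simp: backtracks_to_def)
  from step_acceptedD[OF this less_imp_le[OF \<eta>_pos], folded w_eq z_eq \<kappa>_def]
  show "norm (\<eta> (Suc t) *\<^sub>R F (w (Suc t)) - \<eta> (Suc t) *\<^sub>R F (z (Suc t))) \<le> \<kappa> * norm (w (Suc t) - z (Suc t))"
    "norm (\<eta> (Suc t) *\<^sub>R F (w (Suc t)) - \<eta> (Suc t) *\<^sub>R F (z (Suc (Suc t)))) \<le> norm (w (Suc t) - z (Suc (Suc t)))"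
    by blast+
qed

section \<open>Fejer monotonicity and boundedness\<close>

definition gap :: "nat \<Rightarrow> real" where
  "gap t = (norm (w (Suc t) - z (Suc t)))\<^sup>2 + (norm (w (Suc t) - z (Suc (Suc t))))\<^sup>2"

lemma fejer: "(norm (z (Suc (Suc t)) - zs))\<^sup>2 \<le> (norm (z (Suc t) - zs))\<^sup>2 - (1 - \<kappa>) * gap t"
proof -
  \<comment> \<open>Monotonicity added to the variational inequality at \<open>zs\<close> gives the
    Minty form, with \<open>F\<close> evaluated at \<open>w (Suc t)\<close>.\<close>
  have "0 \<le> (F (w (Suc t)) - F zs) \<bullet> (w (Suc t) - zs)" "0 \<le> F zs \<bullet> (w (Suc t) - zs)"
    using mono sol iterates_in zs_in unfolding monotone_operator_on_def vi_solution_def by blast+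
  then have "0 \<le> F (w (Suc t)) \<bullet> (w (Suc t) - zs)"
    by (simp add: inner_diff_left)
  then have "0 \<le> (\<eta> (Suc t) *\<^sub>R F (w (Suc t))) \<bullet> (w (Suc t) - zs)"
    using \<eta>_pos[of "Suc t"] by simp
  then show ?thesis
    unfolding gap_def
    by (intro extragradient_fejer_inequality[OF accepted(1)] normal_w normal_z
        iterates_in zs_in less_imp_le[OF \<kappa>(1)])
qed

lemma gap_nonneg: "0 \<le> gap t"
  by (simp add: gap_def)

lemma gap_summable: "summable gap"
proof -
  have "summable (\<lambda>t. (1 - \<kappa>) * gap t)"
    using fejer gap_nonneg \<kappa>
    by (intro summable_telescoping_bound[of "\<lambda>t. (norm (z (Suc t) - zs))\<^sup>2"]) auto
  then show ?thesis
    using \<kappa> by (simp add: summable_cmult_iff)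
qed

lemma z_bounded: "norm (z (Suc t) - zs) \<le> norm (z 1 - zs)"
proof (induction t)
  case (Suc t)
  have "(norm (z (Suc (Suc t)) - zs))\<^sup>2 \<le> (norm (z (Suc t) - zs))\<^sup>2"
    using fejer[of t] gap_nonneg[of t] \<kappa> mult_nonneg_nonneg[of "1 - \<kappa>" "gap t"] by linarith
  then show ?case
    using Suc by (meson norm_ge_zero order_trans power2_le_imp_le)
qed simp

text \<open>Each squared distance from \<open>w\<close> to \<open>z\<close> is at most the total of
  the summable gaps, and the \<open>z\<close> iterates are bounded.\<close>

lemma w_bounded:
  obtains R where "\<And>t. norm (w (Suc t) - zs) \<le> R"
proof -
  have "gap t \<le> suminf gap" for t
    using sum_le_suminf[OF gap_summable, of "{t}"] gap_nonneg by simp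
  moreover have "(norm (w (Suc t) - z (Suc t)))\<^sup>2 \<le> gap t" for t
    by (simp add: gap_def)
  ultimately have "(norm (w (Suc t) - z (Suc t)))\<^sup>2 \<le> suminf gap" for t
    by (rule order_trans[rotated])
  then have "norm (w (Suc t) - z (Suc t)) \<le> sqrt (suminf gap)" for t
    by (simp add: real_le_rsqrt)
  then have "norm ((w (Suc t) - z (Suc t)) + (z (Suc t) - zs)) \<le> sqrt (suminf gap) + norm (z 1 - zs)" for t
    using z_bounded by (intro norm_triangle_le add_mono)
  then have "norm (w (Suc t) - zs) \<le> sqrt (suminf gap) + norm (z 1 - zs)" for t
    by simp
  then show thesis
    by (rule that)
qed

section \<open>Lower bound for the stepsizes\<close>

lemma in_cball_iff: "x \<in> cball zs R \<longleftrightarrow> norm (x - zs) \<le> R"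
  by (simp add: dist_norm norm_minus_commute)

lemma compact_ball: "compact (Z \<inter> cball zs R)"
  using closed by (simp add: closed_Int_compact)

text \<open>
  A rejected stepsize may be large, since \<open>\<Prod>\<lambda>\<^sub>t\<close> need not converge, and its trial points may
  then be far away. Only rejected stepsizes \<open>h \<le> 1\<close>, whose trial points stay in a fixed compact
  set, need to be bounded below.
\<close>

lemma rejected_lower_bound:
  obtains L where "0 < L"
    "\<And>t h. \<lbrakk>0 \<le> h; h \<le> 1; \<not> step_accepted Z F \<theta> (z (Suc t)) h\<rbrakk> \<Longrightarrow> \<kappa> < h * L"
proof -
  define R where "R = norm (z 1 - zs)"
  have bound: "\<exists>B. \<forall>x\<in>Z \<inter> cball zs r. norm (F x) \<le> B" for r
  proof -
    obtain L where L: "L > 0"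
      "\<And>x y. x \<in> Z \<inter> cball zs r \<Longrightarrow> y \<in> Z \<inter> cball zs r \<Longrightarrow> norm (F x - F y) \<le> L * norm (x - y)"
      using locally_lipschitz_on_compact[OF loc_lip compact_ball] by blast
    have "norm (F x) \<le> norm (F zs) + L * r" if x: "x \<in> Z \<inter> cball zs r" for x
    proof -
      have "norm (x - zs) \<le> r"
        using x in_cball_iff by blast
      \<comment> \<open>The sign of \<open>r\<close> is not known beforehand; the point
        \<open>x\<close> of the ball forces it to be nonnegative.\<close>
      moreover from this have "zs \<in> Z \<inter> cball zs r"
        using zs_in order_trans[OF norm_ge_zero, of "x - zs" r] by simp
      ultimately show ?thesis
        using x by (intro lipschitz_on_bounded_set_norm_le[OF L(2,1)])
    qed
    then show ?thesis by blast
  qed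
  \<comment> \<open>Two nested bounds: \<open>B\<close> limits the move from an iterate to its first
    trial point, and \<open>B'\<close>, a bound for \<open>F\<close> at that trial point, limits the
    move to the second one.\<close>
  obtain B where B: "\<And>x. x \<in> Z \<inter> cball zs R \<Longrightarrow> norm (F x) \<le> B"
    using bound by blast
  obtain B' where B': "\<And>x. x \<in> Z \<inter> cball zs (R + B) \<Longrightarrow> norm (F x) \<le> B'"
    using bound by blast
  \<comment> \<open>The terms \<open>max 0\<close> make the ball contain the iterate and both trial
    points without a discussion of signs.\<close>
  define K where "K = Z \<inter> cball zs (R + max 0 B + max 0 B')"
  obtain L where L: "L > 0" "\<And>x y. x \<in> K \<Longrightarrow> y \<in> K \<Longrightarrow> norm (F x - F y) \<le> L * norm (x - y)"
    using locally_lipschitz_on_compact[OF loc_lip compact_ball] unfolding K_def by blast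
  have "\<kappa> < h * L" if h: "0 \<le> h" "h \<le> 1" "\<not> step_accepted Z F \<theta> (z (Suc t)) h" for t h
  proof -
    define x where "x = z (Suc t)"
    define u where "u = eg_w Z F x h"
    define v where "v = eg_z Z F x h"
    have x: "x \<in> Z" "norm (x - zs) \<le> R"
      using z_bounded iterates_in by (simp_all add: x_def R_def)
    have scale: "h * norm y \<le> norm y" for y :: 'a
      using h by (simp add: mult_left_le_one_le)
    have "norm (F x) \<le> B"
      using B x in_cball_iff by blast
    then have ux: "norm (u - x) \<le> B"
      using eg_w_displacement(1)[OF x(1) h(1)] scale[of "F x"] by (simp add: u_def)
    have "u \<in> Z"
      by (simp add: u_def eg_in)
    moreover have u: "norm (u - zs) \<le> R + B"
      using norm_triangle_ineq[of "u - x" "x - zs"] ux x(2) by simp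
    ultimately have "norm (F u) \<le> B'"
      using B' in_cball_iff by blast
    then have "norm (v - x) \<le> B'"
      using eg_w_displacement(2)[OF x(1) h(1)] scale[of "F u"] by (simp add: v_def u_def)
    then have v: "norm (v - zs) \<le> R + B'"
      using norm_triangle_ineq[of "v - x" "x - zs"] x(2) by simp
    have "x \<in> K" "u \<in> K" "v \<in> K"
      using x u v unfolding K_def Int_iff in_cball_iff by (auto simp: u_def v_def eg_in)
    then show ?thesis
      using step_rejected_lower_bound[OF h(3,1) \<theta>(2), of L] L
      by (simp add: \<kappa>_def x_def u_def v_def)
  qed
  then show thesis
    using that L(1) by blast
qed

text \<open>Induction on the step. The factor \<open>l t\<close>, at least 1, does not shrink the
  previous stepsize, the Lipschitz caps are controlled on a compact set containing the actual
  iterates, and if backtracking occurs the final stepsize is \<rho> times a rejected one.\<close>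

lemma \<eta>_lower_bound:
  obtains m where "0 < m" "\<And>t. m \<le> \<eta> (Suc t)"
proof -
  obtain L1 where L1: "0 < L1"
    "\<And>t h. \<lbrakk>0 \<le> h; h \<le> 1; \<not> step_accepted Z F \<theta> (z (Suc t)) h\<rbrakk> \<Longrightarrow> \<kappa> < h * L1"
    by (rule rejected_lower_bound) blast
  obtain R where R: "\<And>t. norm (w (Suc t) - zs) \<le> R"
    by (rule w_bounded) blast
  define K where "K = Z \<inter> cball zs (max R (norm (z 1 - zs)))"
  obtain L2 where L2: "L2 > 0" "\<And>x y. x \<in> K \<Longrightarrow> y \<in> K \<Longrightarrow> norm (F x - F y) \<le> L2 * norm (x - y)"
    using locally_lipschitz_on_compact[OF loc_lip compact_ball] unfolding K_def by blast
  have K: "w (Suc t) \<in> K" "z (Suc t) \<in> K" for t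
    using R[of t] z_bounded[of t] iterates_in
    unfolding K_def Int_iff in_cball_iff by (auto simp: le_max_iff_disj)
  \<comment> \<open>In order: the base case, a last rejected stepsize above 1, a last rejected
    stepsize at most 1, and the caps in the trial stepsize.\<close>
  define m where "m = Min {\<eta> 1, \<rho>, \<rho> * (\<kappa> / L1), \<theta> / L2}"
  have m: "m \<le> \<eta> 1" "m \<le> \<rho>" "m \<le> \<rho> * (\<kappa> / L1)" "m \<le> \<theta> / L2"
    by (simp_all add: m_def)
  have m_pos: "0 < m"
    using \<rho> \<kappa> \<theta> L1(1) L2(1) \<eta>_pos by (simp add: m_def)
  have "m \<le> \<eta> (Suc t)" for t
  proof (induction t)
    case (Suc t)
    define h0 where "h0 = trial_step \<theta> (l (Suc t)) (\<eta> (Suc t))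
      (lip_est F (w (Suc t)) (z (Suc t))) (lip_est F (w (Suc t)) (z (Suc (Suc t))))"
    have est: "m * lip_est F (w (Suc t)) y \<le> \<theta>" if "y \<in> K" for y
    proof -
      have "m * lip_est F (w (Suc t)) y \<le> m * L2"
        using m_pos L2 K that by (intro mult_left_mono lip_est_le) auto
      also have "\<dots> \<le> \<theta>"
        using m(4) L2(1) by (simp add: field_simps)
      finally show ?thesis .
    qed
    have "\<eta> (Suc t) \<le> l (Suc t) * \<eta> (Suc t)"
      using l[of "Suc t"] \<eta>_pos[of "Suc t"] by simp
    with Suc have h0: "m \<le> h0"
      unfolding h0_def by (intro trial_step_ge m_pos \<theta> lip_est_nonneg est K) simp
    obtain k where k: "\<eta> (Suc (Suc t)) = \<rho> ^ k * h0"
      and rej: "\<And>j. j < k \<Longrightarrow> \<not> step_accepted Z F \<theta> (z (Suc (Suc t))) (\<rho> ^ j * h0)"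
      using line_search[of "Suc t"] unfolding backtracks_to_def h0_def by blast
    show ?case
    proof (cases k)
      case 0
      then show ?thesis using k h0 by simp
    next
      case (Suc j)
      \<comment> \<open>The last rejected stepsize.\<close>
      define h where "h = \<rho> ^ j * h0"
      have \<eta>h: "\<eta> (Suc (Suc t)) = \<rho> * h"
        using k Suc by (simp add: h_def)
      have h_nonneg: "0 \<le> h"
        using h0 m_pos \<rho> by (simp add: h_def)
      show ?thesis
      proof (cases "h \<le> 1")
        case True
        then have "\<kappa> < h * L1"
          using L1(2) h_nonneg rej[of j] Suc by (simp add: h_def)
        then have "\<rho> * (\<kappa> / L1) \<le> \<rho> * h"
          using L1(1) \<rho> by (simp add: field_simps)
        then show ?thesis using m(3) \<eta>h by linarith
      next
        case False
        then have "\<rho> \<le> \<rho> * h" using \<rho> by simp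
        then show ?thesis using m(2) \<eta>h by linarith
      qed
    qed
  qed (use m(1) in simp)
  then show thesis
    using that m_pos by blast
qed

section \<open>Decay of the residual\<close>

text \<open>The index lags by one: this is the normal vector at \<open>z (Suc t)\<close>, written
  \<xi> with index \<open>t + 1\<close> in the theorem. The same shift applies to
  \<open>res\<close>.\<close>

definition \<xi> :: "nat \<Rightarrow> 'a" where
  "\<xi> t = (1 / \<eta> t) *\<^sub>R (z t - \<eta> t *\<^sub>R F (w t) - z (Suc t))"

definition res :: "nat \<Rightarrow> real" where
  "res t = norm (F (z (Suc t)) + \<xi> t)"

lemma \<eta>_scale_\<xi>: "\<eta> t *\<^sub>R \<xi> t = z t - \<eta> t *\<^sub>R F (w t) - z (Suc t)"
  using \<eta>_pos[of t] by (simp add: \<xi>_def)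

lemma \<xi>_normal: "y \<in> Z \<Longrightarrow> 0 \<le> \<xi> t \<bullet> (z (Suc t) - y)"
  using normal_z[of y t] \<eta>_pos[of t] by (simp add: \<xi>_def)

text \<open>The vector \<open>\<xi> t\<close> was formed with the old stepsize, but a normal cone is
  closed under positive scaling, so the one-step inequality applies with
  \<open>c = h *\<^sub>R \<xi> t\<close> for the new stepsize \<open>h\<close>.\<close>

lemma res_Suc_le: "res (Suc t) \<le> res t"
proof -
  define h where "h = \<eta> (Suc t)"
  have h: "0 < h"
    by (simp add: h_def \<eta>_pos)
  have "0 \<le> (F (z (Suc t)) - F (z (Suc (Suc t)))) \<bullet> (z (Suc t) - z (Suc (Suc t)))"
    using mono iterates_in unfolding monotone_operator_on_def by blast
  then have mono': "0 \<le> (h *\<^sub>R F (z (Suc t)) - h *\<^sub>R F (z (Suc (Suc t)))) \<bullet> (z (Suc t) - z (Suc (Suc t)))"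
    using h by (simp flip: scaleR_diff_right)
  have \<xi>': "0 \<le> (h *\<^sub>R \<xi> t) \<bullet> (z (Suc t) - w (Suc t))"
    using h \<xi>_normal[OF iterates_in(2)] by simp
  have "norm (h *\<^sub>R F (z (Suc (Suc t))) + (z (Suc t) - h *\<^sub>R F (w (Suc t)) - z (Suc (Suc t))))
      \<le> norm (h *\<^sub>R F (z (Suc t)) + h *\<^sub>R \<xi> t)"
    using normal_w normal_z accepted(2) iterates_in
    by (intro extragradient_residual_inequality[OF mono' _ \<xi>']) (simp_all add: h_def)
  then have "norm (h *\<^sub>R (F (z (Suc (Suc t))) + \<xi> (Suc t))) \<le> norm (h *\<^sub>R (F (z (Suc t)) + \<xi> t))"
    by (simp add: h_def \<eta>_scale_\<xi> scaleR_add_right)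
  then show ?thesis
    using h by (simp add: res_def)
qed

lemma res_summable: "summable (\<lambda>t. (res t)\<^sup>2)"
proof -
  obtain m where m: "0 < m" "\<And>t. m \<le> \<eta> (Suc t)"
    by (rule \<eta>_lower_bound) blast
  have "m\<^sup>2 * (res (Suc t))\<^sup>2 \<le> 8 * gap t" for t
  proof -
    define p where "p = norm (w (Suc t) - z (Suc t))"
    define q where "q = norm (w (Suc t) - z (Suc (Suc t)))"
    have "m * res (Suc t) \<le> \<eta> (Suc t) * res (Suc t)"
      using m by (intro mult_right_mono) (auto simp: res_def)
    also have "\<dots> = norm (\<eta> (Suc t) *\<^sub>R F (z (Suc (Suc t))) + \<eta> (Suc t) *\<^sub>R \<xi> (Suc t))"
      using \<eta>_pos[of "Suc t"] unfolding res_def scaleR_add_right[symmetric] norm_scaleR by simp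
    \<comment> \<open>Routing the displacement of \<open>z\<close> through \<open>w\<close> leaves
      only the two distances in \<open>gap\<close> and a difference of \<open>F\<close> values
      controlled by the second test.\<close>
    also have "\<dots> = norm ((w (Suc t) - z (Suc (Suc t))) - (w (Suc t) - z (Suc t))
        - (\<eta> (Suc t) *\<^sub>R F (w (Suc t)) - \<eta> (Suc t) *\<^sub>R F (z (Suc (Suc t)))))"
      unfolding \<eta>_scale_\<xi> by (rule arg_cong[where f = norm]) simp
    also have "\<dots> \<le> (q + p) + q"
      unfolding p_def q_def
      by (rule order_trans[OF norm_triangle_ineq4 add_mono[OF norm_triangle_ineq4 accepted(2)]])
    \<comment> \<open>Symmetrized so that squaring gives the constant 8.\<close>
    also have "\<dots> \<le> 2 * q + 2 * p"
      by (simp add: p_def)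
    finally have "(m * res (Suc t))\<^sup>2 \<le> (2 * q + 2 * p)\<^sup>2"
      using m by (intro power_mono) (auto simp: res_def)
    also have "\<dots> \<le> 8 * (p\<^sup>2 + q\<^sup>2)"
      using sum_squares_bound[of q p] by (simp add: power2_sum power_mult_distrib)
    finally show ?thesis
      by (simp add: gap_def p_def q_def power_mult_distrib)
  qed
  then have "(res (Suc t))\<^sup>2 \<le> 8 / m\<^sup>2 * gap t" for t
    using m(1) by (simp add: pos_le_divide_eq mult.commute)
  then have "summable (\<lambda>t. (res (Suc t))\<^sup>2)"
    by (intro summable_comparison_test'[OF summable_mult[OF gap_summable, of "8 / m\<^sup>2"], where N = 0])
      simp
  then show ?thesis
    by (rule iffD1[OF summable_Suc_iff])
qed

lemma sqrt_times_res_tendsto_0: "(\<lambda>t. sqrt (Suc t) * res t) \<longlonglongrightarrow> 0"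
proof -
  have res_nonneg: "0 \<le> res t" for t
    by (simp add: res_def)
  have "antimono (\<lambda>t. (res t)\<^sup>2)"
    using res_Suc_le res_nonneg by (intro decseq_SucI power_mono)
  then have "(\<lambda>t. real t * (res t)\<^sup>2) \<longlonglongrightarrow> 0"
    by (intro antimono_summable_times_index_tendsto_0 res_summable) auto
  \<comment> \<open>The extra null sequence changes the factor \<open>t\<close> into
    \<open>Suc t\<close>, the true index of the residual.\<close>
  then have "(\<lambda>t. real t * (res t)\<^sup>2 + (res t)\<^sup>2) \<longlonglongrightarrow> 0 + 0"
    by (intro tendsto_add summable_LIMSEQ_zero[OF res_summable])
  then have "(\<lambda>t. sqrt (real t * (res t)\<^sup>2 + (res t)\<^sup>2)) \<longlonglongrightarrow> sqrt (0 + 0)"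
    by (rule tendsto_real_sqrt)
  moreover have "sqrt (real t * (res t)\<^sup>2 + (res t)\<^sup>2) = sqrt (Suc t) * res t" for t
  proof -
    have "real t * (res t)\<^sup>2 + (res t)\<^sup>2 = real (Suc t) * (res t)\<^sup>2"
      by (simp add: algebra_simps)
    then show ?thesis
      using res_nonneg[of t] by (simp only: real_sqrt_mult real_sqrt_abs abs_of_nonneg)
  qed
  ultimately show ?thesis
    by simp
qed

end

theorem proposition2:
  fixes Z :: "(real ^ 'n) set"
    and F :: "real ^ 'n \<Rightarrow> real ^ 'n"
    and z0 :: "real ^ 'n"
    and \<eta>0 \<theta> \<rho> :: real
    and l :: "nat \<Rightarrow> real"
    and z w \<xi> :: "nat \<Rightarrow> real ^ 'n"
    and \<eta> :: "nat \<Rightarrow> real"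
  assumes "Z \<noteq> {}" and "closed Z" and "convex Z"
    and "monotone_operator_on Z F"
    and "locally_lipschitz_on Z F"
    and "\<exists>zs. vi_solution Z F zs"
    and "z0 \<in> Z" and "\<eta>0 > 0"
    and "0 < \<theta>" and "\<theta> < 1" and "0 < \<rho>" and "\<rho> < 1"
    and "\<And>t. l t \<ge> 1" and "l \<longlonglongrightarrow> 1"
    and "pf_ne_eg_infinite_run Z F z0 \<eta>0 \<theta> \<rho> l z w \<eta>"
    and "\<And>t. \<xi> (Suc t) = - (1 / \<eta> t) *\<^sub>R (z (Suc t) - (z t - \<eta> t *\<^sub>R F (w t)))"
  shows "(\<lambda>T. norm (F (z T) + \<xi> T)) \<in> o(\<lambda>T. 1 / sqrt (real T))"
proof -
  obtain zs where zs: "vi_solution Z F zs"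
    using assms(6) by blast
  interpret pf_ne_eg Z F zs \<theta> \<rho> l z w \<eta>
    using assms zs by unfold_locales (auto simp: pf_ne_eg_infinite_run_def)
  have "\<xi> (Suc t) = pf_ne_eg.\<xi> F z w \<eta> t" for t
    unfolding assms(16) \<xi>_def by (simp add: algebra_simps)
  then have "norm (F (z (Suc t)) + \<xi> (Suc t)) / (1 / sqrt (real (Suc t))) = sqrt (Suc t) * res t" for t
    by (simp add: res_def)
  then have "(\<lambda>t. norm (F (z (Suc t)) + \<xi> (Suc t)) / (1 / sqrt (real (Suc t)))) \<longlonglongrightarrow> 0"
    using sqrt_times_res_tendsto_0 by (simp only:)
  \<comment> \<open>Undoes the index shift; the unspecified \<open>\<xi> 0\<close> does not affect
    the limit.\<close>
  then have "(\<lambda>T. norm (F (z T) + \<xi> T) / (1 / sqrt (real T))) \<longlonglongrightarrow> 0"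
    by (rule LIMSEQ_imp_Suc)
  then show ?thesis
    by (rule smalloI_tendsto) (auto intro: eventually_mono[OF eventually_gt_at_top[of 0]])
qed

end
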